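(* Let $A\in\mathbb{R}^{n\times n}$ be symmetric positive-semidefinite, let $U_1\in\mathbb{R}^{n\times n}$ be an orthogonal matrix with $U_1^TAU_1=\mathrm{diag}(\omega_1^2,\dots,\omega_n^2)$, $\omega_i\ge 0$, and let $h>0$ satisfy $0<h\omega_i<\sqrt{2}$ for $i=1,\dots,n$. Given initial values $y_0,v_0\in\mathbb{R}^n$, let $(y_k,v_k)_{k\ge0}$ be the sequence in $\mathbb{R}^n\times\mathbb{R}^n$ generated (without resetting the velocity) by $$y_{k+1}=y_k+hv_{k+1},\qquad v_{k+1}=v_k-hAy_k .$$ Then for every $k\ge 0$ and every $i=1,\dots,n$, $$\begin{pmatrix}(U_1^Ty)_{k,i}\\ (U_1^Tv)_{k,i}\end{pmatrix}=T_i^k\begin{pmatrix}(U_1^Ty)_{0,i}\\ (U_1^Tv)_{0,i}\end{pmatrix}=\begin{pmatrix}-\dfrac{\sin(k\theta_i-\phi_i)}{\sin\phi_i} & \dfrac{\sin(k\theta_i)}{\omega_i\sin\phi_i}\\[2mm] -\dfrac{\omega_i\sin(k\theta_i)}{\sin\phi_i} & \dfrac{\sin(k\theta_i+\phi_i)}{\sin\phi_i}\end{pmatrix}\begin{pmatrix}(U_1^Ty)_{0,i}\\ (U_1^Tv)_{0,i}\end{pmatrix}.$$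
   Context: Notation: $(U_1^Ty)_{k,i}$ and $(U_1^Tv)_{k,i}$ denote the $i$-th components of the vectors $U_1^Ty_k$ and $U_1^Tv_k$. For $i=1,\dots,n$, $$T_i=\begin{pmatrix} 1-\omega_i^2h^2 & h\\ -\omega_i^2h & 1\end{pmatrix},$$ and $\theta_i,\phi_i\in\left(0,\frac{\pi}{2}\right)$ are the angles determined by $$\cos\theta_i=1-\frac{h^2\omega_i^2}{2},\quad \sin\theta_i=h\omega_i\sqrt{1-\frac{h^2\omega_i^2}{4}},\qquad \cos\phi_i=\frac{h\omega_i}{2},\quad \sin\phi_i=\sqrt{1-\frac{h^2\omega_i^2}{4}} .$$ The iteration is the linearization at a local minimum $x^\star$ of the symplectic Euler scheme, with $A$ representing $\nabla^2 f(x^\star)$. *)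

theory Defs
  imports "HOL-Analysis.Analysis"
begin

(* The class operations "*" and "^" act componentwise on "real ^ 'n ^ 'n",
   so powers with respect to the matrix product need their own definition. *)
primrec matrix_pow :: "real ^ 'n ^ 'n \<Rightarrow> nat \<Rightarrow> real ^ 'n ^ 'n" where
  "matrix_pow M 0 = mat 1"
| "matrix_pow M (Suc k) = M ** matrix_pow M k"

definition diag_matrix :: "('n \<Rightarrow> real) \<Rightarrow> real ^ 'n ^ 'n" where
  "diag_matrix d = (\<chi> i j. if i = j then d i else 0)"

definition pos_semidef :: "real ^ 'n ^ 'n \<Rightarrow> bool" where
  "pos_semidef M \<longleftrightarrow> (\<forall>x. 0 \<le> x \<bullet> (M *v x))"

(* Linearised symplectic Euler: the position update uses the new velocity. *)
definition symplectic_euler_iterates ::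
    "real ^ 'n ^ 'n \<Rightarrow> real \<Rightarrow> (nat \<Rightarrow> real ^ 'n) \<Rightarrow> (nat \<Rightarrow> real ^ 'n) \<Rightarrow> bool" where
  "symplectic_euler_iterates A h y v \<longleftrightarrow>
     (\<forall>k. y (Suc k) = y k + h *\<^sub>R v (Suc k) \<and> v (Suc k) = v k - h *\<^sub>R (A *v y k))"

definition step_matrix :: "real \<Rightarrow> real \<Rightarrow> real ^ 2 ^ 2" where
  "step_matrix h w = vector [vector [1 - w\<^sup>2 * h\<^sup>2, h],
                             vector [- (w\<^sup>2 * h), 1]]"

definition is_theta :: "real \<Rightarrow> real \<Rightarrow> real \<Rightarrow> bool" where
  "is_theta h w t \<longleftrightarrow> t \<in> {0 <..< pi / 2} \<and> cos t = 1 - h\<^sup>2 * w\<^sup>2 / 2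
     \<and> sin t = h * w * sqrt (1 - h\<^sup>2 * w\<^sup>2 / 4)"

definition is_phi :: "real \<Rightarrow> real \<Rightarrow> real \<Rightarrow> bool" where
  "is_phi h w p \<longleftrightarrow> p \<in> {0 <..< pi / 2} \<and> cos p = h * w / 2
     \<and> sin p = sqrt (1 - h\<^sup>2 * w\<^sup>2 / 4)"

lemma ex1_angle:
  fixes c s :: real
  assumes "0 < c" "0 < s" "c\<^sup>2 + s\<^sup>2 = 1"
  shows "\<exists>!t. t \<in> {0 <..< pi / 2} \<and> cos t = c \<and> sin t = s"
proof -
  have "s\<^sup>2 > 0" using assms(2) by (rule zero_less_power)
  then have "c\<^sup>2 < 1\<^sup>2" unfolding one_power2 using assms(3) by linarith
  then have c: "c < 1" by (rule power2_less_imp_less) simp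
  define t where "t = arccos c"
  have ct: "cos t = c" using c assms unfolding t_def by simp
  have "sin t = sqrt (1 - c\<^sup>2)" unfolding t_def using c assms by (simp add: sin_arccos)
  also have "1 - c\<^sup>2 = s\<^sup>2" using assms by simp
  finally have st: "sin t = s" using assms by simp
  have "t < arccos 0" unfolding t_def using c assms by (intro arccos_less_arccos) auto
  moreover have "arccos 1 < t" unfolding t_def using c assms by (intro arccos_less_arccos) auto
  ultimately have t: "t \<in> {0 <..< pi / 2}" by simp
  show ?thesis
  proof (rule ex1I)
    show "t \<in> {0 <..< pi / 2} \<and> cos t = c \<and> sin t = s" using t ct st by simp
  next
    fix u assume "u \<in> {0 <..< pi / 2} \<and> cos u = c \<and> sin u = s"
    then have "0 \<le> u" "u \<le> pi" "cos u = c" using pi_gt_zero by auto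
    then show "u = t" unfolding t_def using arccos_cos by metis
  qed
qed

lemma step_bounds:
  fixes h w :: real
  assumes "0 < h * w" "h * w < sqrt 2"
  shows "h\<^sup>2 * w\<^sup>2 < 2"
proof -
  have "(h * w)\<^sup>2 < (sqrt 2)\<^sup>2" using assms by (intro power_strict_mono) auto
  then show ?thesis by (simp add: power_mult_distrib)
qed

lemma ex1_theta:
  assumes "0 < h * w" "h * w < sqrt 2"
  shows "\<exists>!t. is_theta h w t"
proof -
  note b = step_bounds[OF assms]
  have "(1 - h\<^sup>2 * w\<^sup>2 / 2)\<^sup>2 + (h * w * sqrt (1 - h\<^sup>2 * w\<^sup>2 / 4))\<^sup>2 = 1"
    using b by (simp add: power_mult_distrib) (simp add: power2_eq_square algebra_simps)
  then show ?thesis unfolding is_theta_def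
    using b mult_pos_pos[OF assms(1), of "sqrt (1 - h\<^sup>2 * w\<^sup>2 / 4)"] by (intro ex1_angle) auto
qed

lemma ex1_phi:
  assumes "0 < h * w" "h * w < sqrt 2"
  shows "\<exists>!p. is_phi h w p"
proof -
  note b = step_bounds[OF assms]
  have "(h * w / 2)\<^sup>2 + (sqrt (1 - h\<^sup>2 * w\<^sup>2 / 4))\<^sup>2 = 1"
    using b by (simp add: power_mult_distrib power_divide)
  then show ?thesis unfolding is_phi_def using b assms by (intro ex1_angle) auto
qed

end

theory Submission
  imports Defs
begin

text \<open>
  In the eigenbasis of \<open>A\<close> the scheme decouples into the \<open>2 \<times> 2\<close> recursions with matrices
  \<open>T\<^sub>i\<close>. Since \<open>h \<omega>\<^sub>i = 2 cos \<phi>\<^sub>i\<close>, the angles satisfy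
  \<open>cos \<theta>\<^sub>i = 1 - 2 cos\<^sup>2 \<phi>\<^sub>i\<close> and \<open>sin \<theta>\<^sub>i = 2 sin \<phi>\<^sub>i cos \<phi>\<^sub>i\<close>, and with these relations the
  closed form of the powers of \<open>T\<^sub>i\<close> reproduces itself under multiplication by \<open>T\<^sub>i\<close>, by the
  addition theorems.
\<close>

text \<open>The closed form claimed for the \<open>k\<close>-th power, with a real \<open>x\<close>
  in place of \<open>k\<close>, so that the induction step becomes a trigonometric identity in
  \<open>x\<close>.\<close>

definition rotation_form :: "real \<Rightarrow> real \<Rightarrow> real \<Rightarrow> real \<Rightarrow> real ^ 2 ^ 2" where
  "rotation_form w t p x =
     vector [vector [- (sin (x * t - p) / sin p), sin (x * t) / (w * sin p)],
             vector [- (w * sin (x * t) / sin p), sin (x * t + p) / sin p]]"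

lemma vec2_eq_iff:
  fixes a b :: "'a ^ 2"
  shows "a = b \<longleftrightarrow> a $ 1 = b $ 1 \<and> a $ 2 = b $ 2"
  by (simp add: vec_eq_iff forall_2)

text \<open>The last two hypotheses say \<open>cos t = - cos (2 * p)\<close> and
  \<open>sin t = sin (2 * p)\<close>, that is, \<open>t\<close> is \<open>pi - 2 * p\<close> modulo
  \<open>2 * pi\<close>. After eliminating \<open>h\<close> and expanding by the addition theorems,
  each entry is linear in \<open>S\<close> and \<open>C\<close>, with coefficients that agree by
  \<open>a * a + b * b = 1\<close>.\<close>

lemma rotation_form_step:
  fixes h w t p x :: real
  assumes "w \<noteq> 0" and h: "h * w = 2 * cos p" and s: "sin p \<noteq> 0"
    and ct: "cos t = 1 - 2 * (cos p)\<^sup>2" and sn: "sin t = 2 * sin p * cos p"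
  shows "step_matrix h w ** rotation_form w t p x = rotation_form w t p (x + 1)"
proof -
  have h': "h = 2 * cos p / w" using h \<open>w \<noteq> 0\<close> by (simp add: field_simps)
  have x1: "(x + 1) * t = x * t + t" by (simp add: algebra_simps)
  define S C a b where "S = sin (x * t)" and "C = cos (x * t)" and "a = sin p" and "b = cos p"
  have a0: "a \<noteq> 0" using s by (simp add: a_def)
  have ab: "a * a = 1 - b * b"
    using sin_cos_squared_add[of p] by (simp add: a_def b_def power2_eq_square)
  \<comment> \<open>The same reduction for right-nested products, the shape in which
    \<open>algebra_simps\<close> leaves the monomials.\<close>
  have "a * (a * z) = (1 - b * b) * z" for z by (metis ab mult.assoc)
  note ab = ab this
  note defs = S_def[symmetric] C_def[symmetric] a_def[symmetric] b_def[symmetric]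
  show ?thesis
    using \<open>w \<noteq> 0\<close> a0
    unfolding rotation_form_def step_matrix_def vec2_eq_iff matrix_matrix_mult_def x1
    apply (simp add: sum_2 sin_add sin_diff cos_add ct sn h' defs)
    apply (simp add: field_simps power2_eq_square)
    apply (simp add: algebra_simps ab)
    done
qed

lemma matrix_pow_step_matrix:
  assumes "0 < h * w" "is_theta h w t" "is_phi h w p"
  shows "matrix_pow (step_matrix h w) k = rotation_form w t p (real k)"
proof -
  have w: "w \<noteq> 0" using assms(1) by auto
  have s: "sin p \<noteq> 0"
    using assms(3) sin_gt_zero[of p] by (auto simp: is_phi_def)
  have h: "h * w = 2 * cos p" using assms(3) by (simp add: is_phi_def)
  have "h\<^sup>2 * w\<^sup>2 = 4 * (cos p)\<^sup>2" using arg_cong[OF h, of "\<lambda>u. u\<^sup>2"] by (simp add: power_mult_distrib)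
  then have ct: "cos t = 1 - 2 * (cos p)\<^sup>2" using assms(2) by (simp add: is_theta_def)
  \<comment> \<open>The square root in the formula for \<open>sin t\<close> is exactly
    \<open>sin p\<close>.\<close>
  have "sin t = h * w * sin p" using assms(2,3) by (simp add: is_theta_def is_phi_def)
  then have sn: "sin t = 2 * sin p * cos p" using h by simp
  show ?thesis
  proof (induction k)
    case 0
    \<comment> \<open>At \<open>x = 0\<close> the diagonal entries are
      \<open>- sin (- p) / sin p\<close> and \<open>sin p / sin p\<close>, both 1, and the other two
      vanish.\<close>
    show ?case using s by (simp add: rotation_form_def vec2_eq_iff mat_def)
  next
    case (Suc k)
    then show ?case
      using rotation_form_step[OF w h s ct sn, of "real k"] by (simp add: add.commute)
  qed
qed

lemma diag_matrix_mult_vec_component: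
  "(diag_matrix d *v x) $ i = d i * x $ i"
  by (simp add: diag_matrix_def matrix_vector_mult_def if_distrib[of "\<lambda>u. u * _"] cong: if_cong)

text \<open>Inserting \<open>U ** transpose U = mat 1\<close> after \<open>A\<close> gives
  \<open>transpose U ** A = diag_matrix d ** transpose U\<close>.\<close>

lemma diagonalized_component:
  assumes "orthogonal_matrix U" "transpose U ** A ** U = diag_matrix d"
  shows "(transpose U *v (A *v x)) $ i = d i * (transpose U *v x) $ i"
proof -
  have "transpose U ** A = transpose U ** A ** (U ** transpose U)"
    using assms(1) by (simp add: orthogonal_matrix_def)
  also have "\<dots> = diag_matrix d ** transpose U"
    by (simp add: assms(2)[symmetric] matrix_mul_assoc)
  finally show ?thesis
    by (metis diag_matrix_mult_vec_component matrix_vector_mul_assoc)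
qed

lemma symplectic_euler_component:
  assumes "orthogonal_matrix U" "transpose U ** A ** U = diag_matrix (\<lambda>i. (\<omega> i)\<^sup>2)"
    and "symplectic_euler_iterates A h y v"
  shows "(vector [(transpose U *v y k) $ i, (transpose U *v v k) $ i] :: real ^ 2)
      = matrix_pow (step_matrix h (\<omega> i)) k
          *v vector [(transpose U *v y 0) $ i, (transpose U *v v 0) $ i]"
proof (induction k)
  case 0
  show ?case by simp
next
  case (Suc k)
  let ?Y = "\<lambda>k. (transpose U *v y k) $ i" and ?V = "\<lambda>k. (transpose U *v v k) $ i"
  have y: "y (Suc k) = y k + h *\<^sub>R v (Suc k)" and v: "v (Suc k) = v k - h *\<^sub>R (A *v y k)"
    using assms(3) by (auto simp: symplectic_euler_iterates_def)
  have V: "?V (Suc k) = ?V k - h * (\<omega> i)\<^sup>2 * ?Y k"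
    by (simp add: v matrix_vector_mult_diff_distrib matrix_vector_mult_scaleR
        diagonalized_component[OF assms(1,2)]
        del: transpose_matrix_vector)
  have Y: "?Y (Suc k) = ?Y k + h * ?V (Suc k)"
    by (simp add: y matrix_vector_right_distrib matrix_vector_mult_scaleR)
  have "vector [?Y (Suc k), ?V (Suc k)] = step_matrix h (\<omega> i) *v vector [?Y k, ?V k]"
    \<comment> \<open>Substituting the new velocity into the position update produces the entry
      \<open>1 - w\<^sup>2 * h\<^sup>2\<close> of the step matrix, with \<open>w\<close> standing
      for \<open>\<omega> i\<close>.\<close>
    unfolding Y V
    by (simp add: vec2_eq_iff step_matrix_def matrix_vector_mult_def sum_2)
      (simp add: algebra_simps power2_eq_square)
  then show ?case by (simp only: Suc matrix_pow.simps matrix_vector_mul_assoc)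
qed

theorem theorem4p7:
  fixes A U1 :: "real ^ 'n ^ 'n"
    and \<omega> \<theta> \<phi> :: "'n \<Rightarrow> real"
    and h :: real
    and y v :: "nat \<Rightarrow> real ^ 'n"
  assumes "transpose A = A"
    and "pos_semidef A"
    and "orthogonal_matrix U1"
    and "transpose U1 ** A ** U1 = diag_matrix (\<lambda>i. (\<omega> i)\<^sup>2)"
    and "\<forall>i. 0 \<le> \<omega> i"
    and "0 < h"
    and "\<forall>i. 0 < h * \<omega> i \<and> h * \<omega> i < sqrt 2"
    and "\<forall>i. is_theta h (\<omega> i) (\<theta> i)"
    and "\<forall>i. is_phi h (\<omega> i) (\<phi> i)"
    and "symplectic_euler_iterates A h y v"
  shows "\<forall>k i.
    (vector [(transpose U1 *v y k) $ i, (transpose U1 *v v k) $ i] :: real ^ 2)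
      = matrix_pow (step_matrix h (\<omega> i)) k
          *v vector [(transpose U1 *v y 0) $ i, (transpose U1 *v v 0) $ i]
    \<and> matrix_pow (step_matrix h (\<omega> i)) k
          *v vector [(transpose U1 *v y 0) $ i, (transpose U1 *v v 0) $ i]
      = (vector
          [vector [- (sin (real k * \<theta> i - \<phi> i) / sin (\<phi> i)),
                   sin (real k * \<theta> i) / (\<omega> i * sin (\<phi> i))],
           vector [- (\<omega> i * sin (real k * \<theta> i) / sin (\<phi> i)),
                   sin (real k * \<theta> i + \<phi> i) / sin (\<phi> i)]] :: real ^ 2 ^ 2)
          *v vector [(transpose U1 *v y 0) $ i, (transpose U1 *v v 0) $ i]"
proof (intro allI conjI)
  fix k i
  show "(vector [(transpose U1 *v y k) $ i, (transpose U1 *v v k) $ i] :: real ^ 2)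
      = matrix_pow (step_matrix h (\<omega> i)) k
          *v vector [(transpose U1 *v y 0) $ i, (transpose U1 *v v 0) $ i]"
    by (rule symplectic_euler_component[OF assms(3,4,10)])
next
  fix k i
  have "matrix_pow (step_matrix h (\<omega> i)) k = rotation_form (\<omega> i) (\<theta> i) (\<phi> i) (real k)"
    using assms(7-9) by (intro matrix_pow_step_matrix) auto
  then show "matrix_pow (step_matrix h (\<omega> i)) k
          *v vector [(transpose U1 *v y 0) $ i, (transpose U1 *v v 0) $ i]
      = (vector
          [vector [- (sin (real k * \<theta> i - \<phi> i) / sin (\<phi> i)),
                   sin (real k * \<theta> i) / (\<omega> i * sin (\<phi> i))],
           vector [- (\<omega> i * sin (real k * \<theta> i) / sin (\<phi> i)),
                   sin (real k * \<theta> i + \<phi> i) / sin (\<phi> i)]] :: real ^ 2 ^ 2)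
          *v vector [(transpose U1 *v y 0) $ i, (transpose U1 *v v 0) $ i]"
    by (simp only: rotation_form_def)
qed

end
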